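(* Let $G$ be a resolution dag (RD) proof of size $s$ of the clause $C$ from the set $F$ of clauses, and let $d$ be the depth of (the node labeled) $C$ in $G$. Then there is an RTI proof $T$ of $C$ from $F$ of size $<2sd$. If $G$ is regular then $T$ is also regular.
   Context: Clauses are finite sets of literals. Resolution: from $C_0\ni x$ and $C_1\ni\overline x$ infer $(C_0\setminus\{x\})\cup(C_1\setminus\{\overline x\})$. An RD proof of $C$ from $F$ is a finite dag of clause-labeled nodes with a unique out-degree-$0$ node labeled $C$; in-degree-$0$ nodes are labeled by clauses of $F$; every other node has in-degree $2$, is labeled by a variable $x$ and by the resolvent on $x$ of its predecessors' clauses. Size = number of nodes. The depth of a node is the maximum number of edges on a path from an in-degree-$0$ node to it. An RD is regular if for every variable $x$ every path contains at most one node labeled $x$. An RTL proof of $D$ from $F$ is an ordered binary tree $T$ with post-order $<_T$ (nodes of the left subtree of $u$ precede nodes of the right subtree of $u$, which precede $u$) in which each leaf $v$ is labeled by a clause of $F$ or by a clause labeling some node $u<_T v$ (a lemma), each internal node is labeled by a variable $x$ and the clause inferred by resolution on $x$ from the clauses of its two children, and the root is labeled $D$. An input resolution tree is a resolution tree in which every internal node has at least one child that is a leaf. A node $v$ of $T$ is input-derived if the subtree of $T$ rooted at $v$ is an input resolution tree. An RTI proof is an RTL proof in which every leaf $v$ not labeled by a clause of $F$ is labeled by a clause labeling some input-derived node $u<_T v$. An RTI proof is regular if no path from a leaf to the root contains two nodes whose resolution inferences use the same variable. Size = number of nodes.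
   Formalization: The size bound < 2sd is asserted only for d > 0: when G is a single node, d = 0 and the bound would read size < 0, which no tree satisfies. Existence of T and preservation of regularity are asserted for all d. *)

theory Defs
  imports Main "HOL-Library.FSet" "HOL-Library.Sublist"
begin

datatype 'v literal = Pos 'v | Neg 'v

type_synonym 'v clause = "'v literal fset"

definition resolves :: "'v \<Rightarrow> 'v clause \<Rightarrow> 'v clause \<Rightarrow> 'v clause \<Rightarrow> bool" where
  "resolves x C0 C1 D \<longleftrightarrow>
     Pos x |\<in>| C0 \<and> Neg x |\<in>| C1 \<and> D = (C0 |-| {|Pos x|}) |\<union>| (C1 |-| {|Neg x|})"

text \<open>The order of the two premises of an inference is irrelevant: either may contain the
  positive literal.\<close>

definition inference :: "'v \<Rightarrow> 'v clause \<Rightarrow> 'v clause \<Rightarrow> 'v clause \<Rightarrow> bool" where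
  "inference x A B D \<longleftrightarrow> resolves x A B D \<or> resolves x B A D"


subsection \<open>Resolution dags\<close>

text \<open>Edges point from premises to conclusions.  The field \<open>var\<close> is meaningful only at nodes
  that are not sources.\<close>

record ('n, 'v) rdag =
  nodes :: "'n set"
  edges :: "('n \<times> 'n) set"
  label :: "'n \<Rightarrow> 'v clause"
  var :: "'n \<Rightarrow> 'v"

definition source :: "('n, 'v) rdag \<Rightarrow> 'n \<Rightarrow> bool" where
  "source G v \<longleftrightarrow> v \<in> nodes G \<and> (edges G)\<inverse> `` {v} = {}"

definition sink :: "('n, 'v) rdag \<Rightarrow> 'n \<Rightarrow> bool" where
  "sink G v \<longleftrightarrow> v \<in> nodes G \<and> edges G `` {v} = {}"

definition rd_proof :: "'v clause set \<Rightarrow> ('n, 'v) rdag \<Rightarrow> 'v clause \<Rightarrow> bool" where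
  "rd_proof F G C \<longleftrightarrow>
     finite (nodes G) \<and> edges G \<subseteq> nodes G \<times> nodes G \<and> acyclic (edges G) \<and>
     (\<exists>!r. sink G r) \<and> (\<forall>r. sink G r \<longrightarrow> label G r = C) \<and>
     (\<forall>v. source G v \<longrightarrow> label G v \<in> F) \<and>
     (\<forall>v \<in> nodes G. \<not> source G v \<longrightarrow>
        (\<exists>u w. u \<noteq> w \<and> (edges G)\<inverse> `` {v} = {u, w} \<and>
               inference (var G v) (label G u) (label G w) (label G v)))"

definition rd_size :: "('n, 'v) rdag \<Rightarrow> nat" where
  "rd_size G = card (nodes G)"

definition depth :: "('n, 'v) rdag \<Rightarrow> 'n \<Rightarrow> nat" where
  "depth G v = Max {k. \<exists>u. source G u \<and> (u, v) \<in> edges G ^^ k}"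

definition path :: "('n, 'v) rdag \<Rightarrow> 'n list \<Rightarrow> bool" where
  "path G p \<longleftrightarrow> set p \<subseteq> nodes G \<and> successively (\<lambda>u v. (u, v) \<in> edges G) p"

definition rd_regular :: "('n, 'v) rdag \<Rightarrow> bool" where
  "rd_regular G \<longleftrightarrow>
     (\<forall>x p. path G p \<longrightarrow> card {v \<in> set p. \<not> source G v \<and> var G v = x} \<le> 1)"


subsection \<open>Resolution trees with lemmas\<close>

datatype 'v rtree = is_Leaf: Leaf "'v clause" | Node "'v rtree" 'v "'v clause" "'v rtree"

fun root_label :: "'v rtree \<Rightarrow> 'v clause" where
  "root_label (Leaf C) = C"
| "root_label (Node l x C r) = C"

text \<open>A node of a tree is identified with its position, the sequence of left/right turns
  leading to it from the root.\<close>

datatype dir = L | R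

type_synonym pos = "dir list"

fun positions :: "'v rtree \<Rightarrow> pos set" where
  "positions (Leaf C) = {[]}"
| "positions (Node l x C r) = insert [] ((#) L ` positions l \<union> (#) R ` positions r)"

text \<open>The second equation is a dummy value: such a position is not in \<open>positions\<close>.\<close>

fun subtree :: "'v rtree \<Rightarrow> pos \<Rightarrow> 'v rtree" where
  "subtree t [] = t"
| "subtree (Leaf C) (a # p) = Leaf C"
| "subtree (Node l x C r) (L # p) = subtree l p"
| "subtree (Node l x C r) (R # p) = subtree r p"

definition tree_size :: "'v rtree \<Rightarrow> nat" where
  "tree_size T = card (positions T)"

definition clause_at :: "'v rtree \<Rightarrow> pos \<Rightarrow> 'v clause" where
  "clause_at T p = root_label (subtree T p)"

definition leaf_positions :: "'v rtree \<Rightarrow> pos set" where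
  "leaf_positions T = {p \<in> positions T. is_Leaf (subtree T p)}"

text \<open>Post-order on positions: descendants precede their ancestors, and nodes below a left
  child precede nodes below its right sibling.\<close>

definition post_less :: "pos \<Rightarrow> pos \<Rightarrow> bool" where
  "post_less p q \<longleftrightarrow> strict_prefix q p \<or> (\<exists>a p' q'. p = a @ L # p' \<and> q = a @ R # q')"

fun resolution_tree :: "'v rtree \<Rightarrow> bool" where
  "resolution_tree (Leaf C) \<longleftrightarrow> True"
| "resolution_tree (Node l x C r) \<longleftrightarrow>
     inference x (root_label l) (root_label r) C \<and> resolution_tree l \<and> resolution_tree r"

fun input_shape :: "'v rtree \<Rightarrow> bool" where
  "input_shape (Leaf C) \<longleftrightarrow> True"
| "input_shape (Node l x C r) \<longleftrightarrow>
     (is_Leaf l \<or> is_Leaf r) \<and> input_shape l \<and> input_shape r"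

definition input_resolution_tree :: "'v rtree \<Rightarrow> bool" where
  "input_resolution_tree t \<longleftrightarrow> resolution_tree t \<and> input_shape t"

definition input_derived :: "'v rtree \<Rightarrow> pos \<Rightarrow> bool" where
  "input_derived T p \<longleftrightarrow> input_resolution_tree (subtree T p)"

definition rtl_proof :: "'v clause set \<Rightarrow> 'v rtree \<Rightarrow> 'v clause \<Rightarrow> bool" where
  "rtl_proof F T D \<longleftrightarrow> resolution_tree T \<and> root_label T = D \<and>
     (\<forall>v \<in> leaf_positions T. clause_at T v \<in> F \<or>
        (\<exists>u \<in> positions T. post_less u v \<and> clause_at T u = clause_at T v))"

definition rti_proof :: "'v clause set \<Rightarrow> 'v rtree \<Rightarrow> 'v clause \<Rightarrow> bool" where
  "rti_proof F T D \<longleftrightarrow> rtl_proof F T D \<and>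
     (\<forall>v \<in> leaf_positions T. clause_at T v \<notin> F \<longrightarrow>
        (\<exists>u \<in> positions T. post_less u v \<and> input_derived T u \<and> clause_at T u = clause_at T v))"

text \<open>The sequences of resolution variables along the paths between the root and the leaves.\<close>

fun branches :: "'v rtree \<Rightarrow> 'v list set" where
  "branches (Leaf C) = {[]}"
| "branches (Node l x C r) = (#) x ` (branches l \<union> branches r)"

definition tree_regular :: "'v rtree \<Rightarrow> bool" where
  "tree_regular T \<longleftrightarrow> (\<forall>b \<in> branches T. distinct b)"

end

theory Submission
  imports Defs
begin

text \<open>Unfold the dag depth-first from its sink, keeping a set \<open>M\<close> of learned nodes, which initially
  are the sources.  A visit to a node of \<open>M\<close> yields a leaf; a visit to any other node
  recursively visits its two predecessors and learns the node if both visits yield leaves.  Such a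
  cherry (an internal node with two leaf children) is input-derived, so leaves are legitimate
  lemmas, and the cherries correspond to pairwise distinct non-source nodes of the dag.  Every
  internal node of the tree lies above some cherry, and above a given cherry there are at most \<open>d\<close>
  internal nodes, itself included; hence there are at most \<open>(s - 1) * d\<close> internal nodes.  Each
  branch follows a path of the dag, which preserves regularity.\<close>

section \<open>Tree size, height and cherries\<close>

fun internal_nodes :: "'v rtree \<Rightarrow> nat" where
  "internal_nodes (Leaf C) = 0"
| "internal_nodes (Node l x C r) = Suc (internal_nodes l + internal_nodes r)"

fun height :: "'v rtree \<Rightarrow> nat" where
  "height (Leaf C) = 0"
| "height (Node l x C r) = Suc (max (height l) (height r))"

fun cherries :: "'v rtree \<Rightarrow> nat" where
  "cherries (Leaf C) = 0"
| "cherries (Node l x C r) =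
     (if is_Leaf l \<and> is_Leaf r then 1 else cherries l + cherries r)"

lemma cherries_eq_0_iff: "cherries t = 0 \<longleftrightarrow> is_Leaf t"
  by (induction t) auto

lemma internal_nodes_le: "internal_nodes t \<le> height t * cherries t"
proof (induction t)
  case (Node l x C r)
  show ?case
  proof (cases "is_Leaf l \<and> is_Leaf r")
    case True
    then show ?thesis by (cases l; cases r) auto
  next
    case False
    let ?h = "max (height l) (height r)" and ?c = "cherries l + cherries r"
    \<comment> \<open>A child that is not a leaf contains a cherry, so raising the height by one
      adds at least 1 to the bound, which pays for the root.\<close>
    have "?c \<ge> 1" using False cherries_eq_0_iff[of l] cherries_eq_0_iff[of r] by linarith
    moreover have "height l * cherries l + height r * cherries r \<le> ?h * ?c"
      by (simp add: distrib_left add_mono)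
    ultimately have "Suc (internal_nodes l + internal_nodes r) \<le> Suc ?h * ?c"
      using Node by simp
    then show ?thesis using False by auto
  qed
qed simp

lemma finite_positions: "finite (positions t)"
  by (induction t) auto

lemma tree_size_eq: "tree_size t = 2 * internal_nodes t + 1"
proof (induction t)
  case (Node l x C r)
  have "card ((#) L ` positions l \<union> (#) R ` positions r) = tree_size l + tree_size r"
    by (subst card_Un_disjoint)
      (auto simp: finite_positions card_image tree_size_def)
  then show ?case
    using Node by (subst tree_size_def) (auto simp: finite_positions card_insert_if)
qed (simp add: tree_size_def)

section \<open>Lemmas along the post-order\<close>

lemma post_less_Cons: "post_less p q \<Longrightarrow> post_less (a # p) (a # q)"
  unfolding post_less_def by (metis append_Cons strict_prefix_simps(3))

lemma post_less_L_R: "post_less (L # p) (R # q)"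
  unfolding post_less_def by (metis append_Nil)

text \<open>No order is imposed on \<open>p\<close>: every node of a left subtree precedes every
  node of its right sibling, so existence alone suffices there.\<close>

definition derived_in :: "'v rtree \<Rightarrow> 'v clause \<Rightarrow> bool" where
  "derived_in T D \<longleftrightarrow> (\<exists>p \<in> positions T. input_derived T p \<and> clause_at T p = D)"

definition derived_before :: "'v rtree \<Rightarrow> pos \<Rightarrow> 'v clause \<Rightarrow> bool" where
  "derived_before T q D \<longleftrightarrow>
     (\<exists>p \<in> positions T. post_less p q \<and> input_derived T p \<and> clause_at T p = D)"

text \<open>\<open>A\<close> holds the clauses available before \<open>T\<close> is entered, be they
  axioms or lemmas derived further left; this makes the property compositional.\<close>

definition leaves_justified :: "'v clause set \<Rightarrow> 'v rtree \<Rightarrow> bool" where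
  "leaves_justified A T \<longleftrightarrow>
     (\<forall>q \<in> leaf_positions T. clause_at T q \<in> A \<or> derived_before T q (clause_at T q))"

lemma derived_in_Node:
  assumes "derived_in l D \<or> derived_in r D"
  shows "derived_in (Node l x C r) D"
proof -
  from assms obtain a p where "p \<in> positions (case a of L \<Rightarrow> l | R \<Rightarrow> r)"
    "input_derived (case a of L \<Rightarrow> l | R \<Rightarrow> r) p" "clause_at (case a of L \<Rightarrow> l | R \<Rightarrow> r) p = D"
    unfolding derived_in_def by (metis dir.case)
  then show ?thesis
    unfolding derived_in_def input_derived_def clause_at_def
    by (intro bexI[of _ "a # p"]) (auto split: dir.splits)
qed

lemma leaves_justified_Leaf: "leaves_justified A (Leaf C) \<longleftrightarrow> C \<in> A \<or> derived_before (Leaf C) [] C"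
  by (simp add: leaves_justified_def leaf_positions_def clause_at_def)

text \<open>The right subtree may assume a larger set \<open>B\<close>, since all that the left
  subtree derives comes earlier in the post-order.\<close>

lemma leaves_justified_Node:
  assumes l: "leaves_justified A l" and r: "leaves_justified B r"
    and B: "\<And>D. D \<in> B \<Longrightarrow> D \<in> A \<or> derived_in l D"
  shows "leaves_justified A (Node l x C r)"
  unfolding leaves_justified_def
proof
  let ?T = "Node l x C r"
  have L: "derived_before ?T (L # q) D" if d: "derived_before l q D" for q D
  proof -
    obtain p where "p \<in> positions l" "post_less p q" "input_derived l p"
      "clause_at l p = D"
      using d unfolding derived_before_def by blast
    then show ?thesis
      unfolding derived_before_def input_derived_def clause_at_def
      by (intro bexI[of _ "L # p"]) (simp_all add: post_less_Cons post_less_L_R)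
  qed
  have R: "derived_before ?T (R # q) D" if d: "derived_before r q D" for q D
  proof -
    obtain p where "p \<in> positions r" "post_less p q" "input_derived r p"
      "clause_at r p = D"
      using d unfolding derived_before_def by blast
    then show ?thesis
      unfolding derived_before_def input_derived_def clause_at_def
      by (intro bexI[of _ "R # p"]) (simp_all add: post_less_Cons post_less_L_R)
  qed
  have LR: "derived_before ?T (R # q) D" if d: "derived_in l D" for q D
  proof -
    obtain p where "p \<in> positions l" "input_derived l p"
      "clause_at l p = D"
      using d unfolding derived_in_def by blast
    then show ?thesis
      unfolding derived_before_def input_derived_def clause_at_def
      by (intro bexI[of _ "L # p"]) (simp_all add: post_less_Cons post_less_L_R)
  qed
  fix q assume "q \<in> leaf_positions ?T"
  then consider q' where "q = L # q'" "q' \<in> leaf_positions l"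
    | q' where "q = R # q'" "q' \<in> leaf_positions r"
    by (auto simp: leaf_positions_def)
  then show "clause_at ?T q \<in> A \<or> derived_before ?T q (clause_at ?T q)"
  proof cases
    case 1
    then have "clause_at ?T q = clause_at l q'" by (simp add: clause_at_def)
    then show ?thesis using 1 l L unfolding leaves_justified_def by metis
  next
    case 2
    then have "clause_at ?T q = clause_at r q'" by (simp add: clause_at_def)
    then show ?thesis using 2 r R LR B unfolding leaves_justified_def by metis
  qed
qed

text \<open>The tree \<open>T\<close> results from visiting \<open>v\<close> while \<open>M\<close> is the set of learned nodes, which then
  grows to \<open>M'\<close>.\<close>

locale dag_unfolding =
  fixes G :: "('n, 'v) rdag" and v :: 'n and M :: "'n set" and T :: "'v rtree" and M' :: "'n set"
  assumes learned_mono: "M \<subseteq> M'"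
    and learned_nodes: "M' \<subseteq> nodes G"
    and resolution: "resolution_tree T"
    and root: "root_label T = label G v"
    and card_learned: "card M' = card M + cherries T"
    and height_le: "height T \<le> depth G v"
    and justified: "leaves_justified (label G ` M) T"
    and learned_derived: "\<And>x. x \<in> M' \<Longrightarrow> x \<in> M \<or> derived_in T (label G x)"
    and branch_path: "\<And>b. b \<in> branches T \<Longrightarrow> \<exists>p. b = map (var G) p \<and> path G (rev p) \<and>
       (\<forall>x \<in> set p. \<not> source G x) \<and> (p \<noteq> [] \<longrightarrow> hd p = v)"

section \<open>Well-foundedness and depth of the dag\<close>

context
  fixes F :: "'v clause set" and G :: "('n, 'v) rdag" and C :: "'v clause"
  assumes rd: "rd_proof F G C"
begin

lemma wf_edges: "wf (edges G)"
  using rd unfolding rd_proof_def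
  by (meson finite_SigmaI finite_acyclic_wf finite_subset)

lemma edge_nodes: "(u, v) \<in> edges G \<Longrightarrow> u \<in> nodes G \<and> v \<in> nodes G"
  using rd unfolding rd_proof_def by auto

text \<open>Walking backwards along edges ends in a source by well-foundedness. Thus the set under
  \<open>Max\<close> in \<open>depth\<close> is nonempty.\<close>

lemma ex_source:
  assumes "v \<in> nodes G"
  shows "\<exists>u k. source G u \<and> (u, v) \<in> edges G ^^ k"
  using wf_edges assms
proof (induction v rule: wf_induct_rule)
  case (less v)
  show ?case
  proof (cases "source G v")
    case True
    then show ?thesis by (metis relpow_0_I)
  next
    case False
    then obtain w where w: "(w, v) \<in> edges G" using less.prems by (auto simp: source_def)
    then show ?thesis using less.IH[of w] edge_nodes by (meson relpow_Suc_I)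
  qed
qed

text \<open>A walk of positive length into \<open>v\<close> is a walk into one of finitely many
  predecessors, extended by one edge.\<close>

lemma finite_source_distances: "finite {k. \<exists>u. source G u \<and> (u, v) \<in> edges G ^^ k}"
  using wf_edges
proof (induction v rule: wf_induct_rule)
  case (less v)
  let ?S = "\<lambda>v. {k. \<exists>u. source G u \<and> (u, v) \<in> edges G ^^ k}"
  have "?S v \<subseteq> insert 0 (\<Union>w \<in> (edges G)\<inverse> `` {v}. Suc ` ?S w)"
  proof
    fix k assume "k \<in> ?S v"
    then show "k \<in> insert 0 (\<Union>w \<in> (edges G)\<inverse> `` {v}. Suc ` ?S w)"
      by (cases k) (auto elim!: relpow_Suc_E)
  qed
  moreover have "finite ((edges G)\<inverse> `` {v})"
    by (rule finite_subset[of _ "nodes G"]) (use rd edge_nodes in \<open>auto simp: rd_proof_def\<close>)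
  ultimately show ?case using less by (elim finite_subset) auto
qed

text \<open>A longest walk from a source to \<open>u\<close> extends along the edge to
  \<open>v\<close>. Hence each level of the unfolding uses up depth.\<close>

lemma depth_less:
  assumes e: "(u, v) \<in> edges G"
  shows "depth G u < depth G v"
proof -
  let ?S = "\<lambda>v. {k. \<exists>u. source G u \<and> (u, v) \<in> edges G ^^ k}"
  have "?S u \<noteq> {}" using ex_source edge_nodes[OF e] by blast
  then have "depth G u \<in> ?S u" unfolding depth_def using finite_source_distances Max_in by blast
  then have "Suc (depth G u) \<in> ?S v" using e by auto
  then have "Suc (depth G u) \<le> depth G v"
    unfolding depth_def using finite_source_distances Max_ge by blast
  then show ?thesis by simp
qed

section \<open>The depth-first unfolding\<close>

lemma unfolding_exists:
  assumes "v \<in> nodes G" "{u. source G u} \<subseteq> M" "M \<subseteq> nodes G"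
  shows "\<exists>T M'. dag_unfolding G v M T M'"
  using wf_edges assms
\<comment> \<open>\<open>M\<close> must vary: the second predecessor is visited with what the first
  visit has learned.\<close>
proof (induction v arbitrary: M rule: wf_induct_rule)
  case (less v)
  have fin: "finite (nodes G)" using rd by (simp add: rd_proof_def)
  show ?case
  proof (cases "v \<in> M")
    case True
    then have "dag_unfolding G v M (Leaf (label G v)) M"
      using less.prems by unfold_locales (auto simp: leaves_justified_Leaf path_def)
    then show ?thesis by blast
  next
    case False
    then have nsv: "\<not> source G v" using less.prems by auto
    then obtain u w where uw: "(edges G)\<inverse> `` {v} = {u, w}"
      and inf: "inference (var G v) (label G u) (label G w) (label G v)"
      using rd less.prems unfolding rd_proof_def by metis
    have eu: "(u, v) \<in> edges G" and ew: "(w, v) \<in> edges G" using uw by auto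
    obtain T1 M1 where "dag_unfolding G u M T1 M1"
      using less.IH[OF eu, of M] less.prems edge_nodes[OF eu] by blast
    then interpret l: dag_unfolding G u M T1 M1 .
    have "{u. source G u} \<subseteq> M1" using l.learned_mono less.prems by blast
    then obtain T2 M2 where "dag_unfolding G w M1 T2 M2"
      using less.IH[OF ew, of M1] l.learned_nodes edge_nodes[OF ew] by blast
    then interpret r: dag_unfolding G w M1 T2 M2 .
    let ?T = "Node T1 (var G v) (label G v) T2"
    let ?ch = "is_Leaf T1 \<and> is_Leaf T2"
    let ?M' = "if ?ch then insert v M2 else M2"
    have res: "resolution_tree ?T" using l.resolution r.resolution l.root r.root inf by simp
    have "dag_unfolding G v M ?T ?M'"
    proof unfold_locales
      show "M \<subseteq> ?M'" using l.learned_mono r.learned_mono by auto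
      show "?M' \<subseteq> nodes G" using r.learned_nodes less.prems by simp
      show "resolution_tree ?T" by (rule res)
      show "height ?T \<le> depth G v"
        using l.height_le r.height_le depth_less[OF eu] depth_less[OF ew] by simp
      show "card ?M' = card M + cherries ?T"
      proof (cases ?ch)
        case True
        \<comment> \<open>Visits that yield leaves learn nothing, so \<open>M2 = M\<close>; thus
          \<open>v\<close> is new and the count rises by exactly one.\<close>
        then have "card M2 = card M"
          using l.card_learned r.card_learned by (simp add: cherries_eq_0_iff[THEN iffD2])
        moreover have "finite M2" using r.learned_nodes fin by (rule finite_subset)
        ultimately have "M2 = M"
          using l.learned_mono r.learned_mono card_subset_eq[of M2 M] by auto
        then show ?thesis using True False \<open>finite M2\<close> by simp
      next
        case False
        then show ?thesis using l.card_learned r.card_learned by auto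
      qed
      show "leaves_justified (label G ` M) ?T"
      proof (rule leaves_justified_Node[OF l.justified r.justified])
        fix D assume "D \<in> label G ` M1"
        then obtain x where "x \<in> M1" "D = label G x" by blast
        then show "D \<in> label G ` M \<or> derived_in T1 D" using l.learned_derived[of x] by auto
      qed
      show "x \<in> M \<or> derived_in ?T (label G x)" if x: "x \<in> ?M'" for x
      proof (cases "x \<in> M2")
        case True
        then show ?thesis using l.learned_derived[of x] r.learned_derived[of x]
          by (auto intro: derived_in_Node)
      next
        case False
        \<comment> \<open>A node outside \<open>M2\<close> can only be \<open>v\<close>, learned at
          a cherry, whose shape makes the root input-derived.\<close>
        then have ch: ?ch and "x = v" using x by (auto split: if_splits)
        have "input_shape ?T" using ch by (cases T1; cases T2) auto
        then have "input_derived ?T []" using res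
          by (simp add: input_derived_def input_resolution_tree_def)
        then show ?thesis using \<open>x = v\<close>
          unfolding derived_in_def by (intro disjI2 bexI[of _ "[]"]) (auto simp: clause_at_def)
      qed
      show "\<exists>p. b = map (var G) p \<and> path G (rev p) \<and>
         (\<forall>x \<in> set p. \<not> source G x) \<and> (p \<noteq> [] \<longrightarrow> hd p = v)" if b: "b \<in> branches ?T" for b
      proof -
        obtain b' where b': "b = var G v # b'" "b' \<in> branches T1 \<union> branches T2" using b by auto
        obtain p where p: "b' = map (var G) p" "path G (rev p)" "\<forall>x \<in> set p. \<not> source G x"
          "p \<noteq> [] \<longrightarrow> hd p = u \<or> hd p = w"
          using b'(2) l.branch_path[of b'] r.branch_path[of b'] by blast
        \<comment> \<open>Branches run down from the root, dag paths towards the conclusion, hence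
          the reversal. If \<open>p\<close> is nonempty, its head is a predecessor of
          \<open>v\<close>, so \<open>v\<close> can be appended to \<open>rev p\<close>.\<close>
        have "path G (rev (v # p))"
          using p(2,4) eu ew less.prems(1)
          by (auto simp: path_def successively_append_iff last_rev)
        then show ?thesis using p b' nsv by (intro exI[of _ "v # p"]) auto
      qed
    qed simp
    then show ?thesis by blast
  qed
qed

section \<open>Regularity along dag paths\<close>

lemma path_distinct:
  assumes "path G p"
  shows "distinct p"
proof -
  \<comment> \<open>Transitivity of the closure extends the relation from neighbours to all pairs;
    acyclicity makes it irreflexive.\<close>
  have "successively (\<lambda>u v. (u, v) \<in> (edges G)\<^sup>+) p"
    using assms unfolding path_def by (auto elim: successively_mono)
  then have "sorted_wrt (\<lambda>u v. (u, v) \<in> (edges G)\<^sup>+) p"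
    by (subst (asm) successively_conv_sorted_wrt) (auto intro: transpI)
  then have "sorted_wrt (\<noteq>) p"
    using rd by (auto simp: rd_proof_def acyclic_def elim!: sorted_wrt_mono_rel[rotated])
  then show ?thesis by (induction p) auto
qed

text \<open>\<open>rd_regular\<close> counts a set of nodes, so it only excludes different nodes
  sharing a variable; that no node occurs twice comes from \<open>path_distinct\<close>.\<close>

lemma regular_path_distinct_vars:
  assumes "rd_regular G" "path G p" "\<forall>x \<in> set p. \<not> source G x"
  shows "distinct (map (var G) p)"
proof -
  have "inj_on (var G) (set p)"
  proof (rule inj_onI)
    fix x y assume xy: "x \<in> set p" "y \<in> set p" "var G x = var G y"
    have "card {v \<in> set p. \<not> source G v \<and> var G v = var G x} \<le> Suc 0"
      using assms unfolding rd_regular_def by auto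
    then show "x = y" using xy assms(3) by (subst (asm) card_le_Suc0_iff_eq) auto
  qed
  then show ?thesis using path_distinct[OF assms(2)] by (simp add: distinct_map)
qed

end

theorem theorem3p3:
  fixes F :: "'v clause set" and G :: "('n, 'v) rdag" and C :: "'v clause"
    and r :: 'n and s d :: nat
  assumes "rd_proof F G C"
    and "rd_size G = s"
    and "sink G r"
    and "depth G r = d"
  shows "\<exists>T :: 'v rtree. rti_proof F T C \<and> (d > 0 \<longrightarrow> tree_size T < 2 * s * d) \<and>
           (rd_regular G \<longrightarrow> tree_regular T)"
proof -
  note rd = assms(1)
  let ?M = "{u. source G u}"
  have r: "r \<in> nodes G" and lab: "label G r = C" and fin: "finite (nodes G)"
    and src: "\<And>v. source G v \<Longrightarrow> label G v \<in> F"
    using assms unfolding rd_proof_def sink_def by auto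
  have M: "?M \<subseteq> nodes G" by (auto simp: source_def)
  obtain T M' where "dag_unfolding G r ?M T M'"
    using unfolding_exists[OF rd r order_refl M] by blast
  then interpret dag_unfolding G r ?M T M' .
  \<comment> \<open>The initially learned nodes are sources, so their clauses are axioms from
    \<open>F\<close>.\<close>
  have just: "clause_at T v \<in> F \<or>
      (\<exists>u \<in> positions T. post_less u v \<and> input_derived T u \<and> clause_at T u = clause_at T v)"
    if "v \<in> leaf_positions T" for v
    using justified that src
    by (fastforce simp: leaves_justified_def derived_before_def)
  have rti: "rti_proof F T C"
    unfolding rti_proof_def rtl_proof_def using resolution root lab just by blast
  have size: "tree_size T < 2 * s * d" if "d > 0"
  proof -
    \<comment> \<open>The final learned set also contains the sources, of which there is at least
      one; this leaves at most \<open>s - 1\<close> cherries.\<close>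
    have "?M \<noteq> {}" using ex_source[OF rd r] by blast
    then have "card ?M \<ge> 1" using M fin by (simp add: Suc_le_eq card_gt_0_iff finite_subset)
    moreover have "card M' \<le> s"
      using learned_nodes fin assms(2) by (auto simp: rd_size_def intro: card_mono)
    ultimately have "Suc (cherries T) \<le> s" using card_learned by simp
    then have "d * Suc (cherries T) \<le> d * s" by (rule mult_le_mono2)
    moreover have "internal_nodes T \<le> d * cherries T"
      using internal_nodes_le[of T] height_le assms(4) by (meson le_trans mult_le_mono1)
    ultimately have "internal_nodes T + d \<le> s * d" by (simp add: mult.commute)
    \<comment> \<open>Doubling turns the slack \<open>d\<close> into at least 2, which absorbs the 1
      in \<open>tree_size_eq\<close> and keeps the inequality strict.\<close>
    then show ?thesis using that by (simp add: tree_size_eq)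
  qed
  have "tree_regular T" if "rd_regular G"
    unfolding tree_regular_def
  proof
    fix b assume "b \<in> branches T"
    then obtain p where p: "b = map (var G) p" "path G (rev p)" "\<forall>x \<in> set p. \<not> source G x"
      using branch_path by blast
    then have "distinct (map (var G) (rev p))"
      using regular_path_distinct_vars[OF rd that] by simp
    then show "distinct b" using p(1) by (simp add: distinct_map)
  qed
  then show ?thesis using rti size by blast
qed

end
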